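(* Let $L$ be a residuated lattice. Then the following assertions are equivalent: (1) $L$ satisfies the descending chain condition, i.e. every strictly descending chain $F_1\supset F_2\supset\cdots$ of filters of $L$ is finite; (2) $L$ satisfies the minimal condition, i.e. every nonempty collection $\mathcal C$ of filters of $L$ has a minimal element with respect to inclusion; (3) each system of filters of $L$ has a least element with respect to inclusion.
   Context: A residuated lattice is an algebra $(L,\wedge,\vee,\odot,\rightarrow,0,1)$ such that $(L,\wedge,\vee,0,1)$ is a bounded lattice, $(L,\odot,1)$ is a commutative monoid, and $x\odot y\leq z$ iff $x\leq y\rightarrow z$ for all $x,y,z\in L$. A filter of $L$ is a nonempty subset $F\subseteq L$ closed under $\odot$ and upward closed. A system of filters of $L$ is a nonempty family $\mathcal F$ of filters of $L$ that is down-directed under inclusion: for all $F,G\in\mathcal F$ there is $H\in\mathcal F$ with $H\subseteq F\cap G$. *)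

theory Defs
  imports Main
begin

(* The bounds 0 and 1 of the lattice are bot and top; the product is the multiplication *,
   and one_eq_top identifies its unit 1 with the greatest element. *)
class residuated_lattice = bounded_lattice + comm_monoid_mult +
  fixes residuum :: "'a \<Rightarrow> 'a \<Rightarrow> 'a"
  assumes one_eq_top: "1 = top"
    and residuation: "x * y \<le> z \<longleftrightarrow> x \<le> residuum y z"

definition rl_filter :: "'a::residuated_lattice set \<Rightarrow> bool" where
  "rl_filter F \<longleftrightarrow> F \<noteq> {} \<and> (\<forall>x\<in>F. \<forall>y\<in>F. x * y \<in> F) \<and> (\<forall>x\<in>F. \<forall>y. x \<le> y \<longrightarrow> y \<in> F)"

definition filter_system :: "'a::residuated_lattice set set \<Rightarrow> bool" where
  "filter_system \<F> \<longleftrightarrow> \<F> \<noteq> {} \<and> (\<forall>F\<in>\<F>. rl_filter F) \<and>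
     (\<forall>F\<in>\<F>. \<forall>G\<in>\<F>. \<exists>H\<in>\<F>. H \<subseteq> F \<inter> G)"

(* The type argument stands for the residuated lattice L. *)
definition filter_dcc :: "'a::residuated_lattice itself \<Rightarrow> bool" where
  "filter_dcc L \<longleftrightarrow> \<not> (\<exists>F :: nat \<Rightarrow> 'a set. (\<forall>n. rl_filter (F n)) \<and> (\<forall>n. F (Suc n) \<subset> F n))"

definition filter_minimal_condition :: "'a::residuated_lattice itself \<Rightarrow> bool" where
  "filter_minimal_condition L \<longleftrightarrow>
     (\<forall>\<C> :: 'a set set. \<C> \<noteq> {} \<and> (\<forall>F\<in>\<C>. rl_filter F) \<longrightarrow>
        (\<exists>M\<in>\<C>. \<forall>F\<in>\<C>. F \<subseteq> M \<longrightarrow> F = M))"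

end

theory Submission
  imports Defs
begin

text \<open>The implications close a cycle: descending chain condition, minimal condition, least
  elements of systems, and back. A collection without a minimal element lets one descend forever, by
  dependent choice (\<open>filter_minimal_condition_if_dcc\<close>). In a down-directed family a
  minimal member is already least (\<open>filter_system_has_least\<close>). Conversely, a descending
  sequence of filters is itself a system, and a least member would be a place where the descent
  stops (\<open>filter_system_range\<close>,
  \<open>filter_dcc_if_systems_have_least\<close>).\<close>

lemma filter_minimal_condition_if_dcc:
  assumes "filter_dcc TYPE('a::residuated_lattice)"
  shows "filter_minimal_condition TYPE('a)"
proof (rule ccontr)
  assume "\<not> filter_minimal_condition TYPE('a)"
  then obtain \<C> :: "'a set set" where "\<C> \<noteq> {}" and filters: "\<forall>F\<in>\<C>. rl_filter F"
    and no_minimal: "\<not> (\<exists>M\<in>\<C>. \<forall>F\<in>\<C>. F \<subseteq> M \<longrightarrow> F = M)"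
    unfolding filter_minimal_condition_def not_all not_imp by (elim exE conjE)
  from no_minimal have smaller: "\<exists>F\<in>\<C>. F \<subset> M" if "M \<in> \<C>" for M
    using that by (simp add: psubset_eq)
  \<comment> \<open>Dependent choice: start anywhere in \<open>\<C>\<close> and keep passing to a
    strictly smaller member.\<close>
  have "\<exists>F. \<forall>n::nat. F n \<in> \<C> \<and> F (Suc n) \<subset> F n"
  proof (rule dependent_nat_choice)
    show "\<exists>F. F \<in> \<C>" using \<open>\<C> \<noteq> {}\<close> by blast
    show "\<exists>G. G \<in> \<C> \<and> G \<subset> F" if "F \<in> \<C>" for F and n :: nat
      using smaller[OF that] by blast
  qed
  then obtain F :: "nat \<Rightarrow> 'a set" where "\<And>n. F n \<in> \<C>" "\<And>n. F (Suc n) \<subset> F n" by iprover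
  with filters have "\<exists>F :: nat \<Rightarrow> 'a set. (\<forall>n. rl_filter (F n)) \<and> (\<forall>n. F (Suc n) \<subset> F n)"
    by (intro exI[of _ F]) simp
  with assms show False
    unfolding filter_dcc_def by contradiction
qed

lemma filter_system_has_least:
  assumes "filter_minimal_condition TYPE('a::residuated_lattice)"
    and "filter_system (\<F> :: 'a set set)"
  shows "\<exists>M\<in>\<F>. \<forall>F\<in>\<F>. M \<subseteq> F"
proof -
  from assms obtain M where "M \<in> \<F>" and minimal: "\<forall>F\<in>\<F>. F \<subseteq> M \<longrightarrow> F = M"
    unfolding filter_minimal_condition_def filter_system_def by metis
  have "M \<subseteq> F" if "F \<in> \<F>" for F
  proof -
    \<comment> \<open>Directedness makes \<open>M\<close> and \<open>F\<close> comparable: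
      minimality forces the common lower bound \<open>H\<close> to equal \<open>M\<close>, so
      \<open>M\<close> lies below \<open>F\<close>.\<close>
    from assms(2) \<open>M \<in> \<F>\<close> that obtain H where "H \<in> \<F>" "H \<subseteq> M \<inter> F"
      unfolding filter_system_def by blast
    with minimal show ?thesis by blast
  qed
  with \<open>M \<in> \<F>\<close> show ?thesis by blast
qed

lemma filter_system_range:
  fixes F :: "nat \<Rightarrow> 'a::residuated_lattice set"
  assumes "\<And>n. rl_filter (F n)" and "antimono F"
  shows "filter_system (range F)"
proof -
  \<comment> \<open>Along a chain, the term with the later index serves as the common lower bound
    that a system requires.\<close>
  have "F (max m n) \<subseteq> F m \<inter> F n" for m n
    using antimonoD[OF assms(2), of m "max m n"] antimonoD[OF assms(2), of n "max m n"] by simp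
  then have "\<exists>k. F k \<subseteq> F m \<inter> F n" for m n by iprover
  with assms(1) show ?thesis
    unfolding filter_system_def by simp
qed

lemma filter_dcc_if_systems_have_least:
  assumes "\<And>\<F> :: 'a::residuated_lattice set set. filter_system \<F> \<Longrightarrow> \<exists>M\<in>\<F>. \<forall>F\<in>\<F>. M \<subseteq> F"
  shows "filter_dcc TYPE('a)"
  unfolding filter_dcc_def
proof
  assume "\<exists>F :: nat \<Rightarrow> 'a set. (\<forall>n. rl_filter (F n)) \<and> (\<forall>n. F (Suc n) \<subset> F n)"
  then obtain F :: "nat \<Rightarrow> 'a set"
    where filters: "\<And>n. rl_filter (F n)" and desc: "\<And>n. F (Suc n) \<subset> F n" by blast
  have "antimono F"
    using lift_Suc_antimono_le[of F] desc by (simp add: antimonoI psubset_imp_subset)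
  with filters have "filter_system (range F)" by (rule filter_system_range)
  \<comment> \<open>The least member sits at some index \<open>n\<close>, but the next term
    \<open>F (Suc n)\<close> is strictly smaller.\<close>
  from assms[OF this] obtain n where "\<forall>m. F n \<subseteq> F m" by auto
  with desc[of n] show False by (simp add: less_le_not_le)
qed

theorem proposition4p4:
  shows "(filter_dcc TYPE('a::residuated_lattice) \<longleftrightarrow> filter_minimal_condition TYPE('a)) \<and>
    (filter_minimal_condition TYPE('a) \<longleftrightarrow>
      (\<forall>\<F> :: 'a set set. filter_system \<F> \<longrightarrow> (\<exists>M\<in>\<F>. \<forall>F\<in>\<F>. M \<subseteq> F)))"
proof (intro conjI iffI)
  show "filter_minimal_condition TYPE('a)" if "filter_dcc TYPE('a)"
    using that by (rule filter_minimal_condition_if_dcc)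
  show "\<forall>\<F> :: 'a set set. filter_system \<F> \<longrightarrow> (\<exists>M\<in>\<F>. \<forall>F\<in>\<F>. M \<subseteq> F)"
    if "filter_minimal_condition TYPE('a)"
    using filter_system_has_least[OF that] by simp
  \<comment> \<open>The two converse directions go around the cycle: this one passes through least
    elements of systems, the last one through the chain condition.\<close>
  show "filter_dcc TYPE('a)" if "filter_minimal_condition TYPE('a)"
    using filter_system_has_least[OF that] by (rule filter_dcc_if_systems_have_least)
  show "filter_minimal_condition TYPE('a)"
    if "\<forall>\<F> :: 'a set set. filter_system \<F> \<longrightarrow> (\<exists>M\<in>\<F>. \<forall>F\<in>\<F>. M \<subseteq> F)"
  proof (rule filter_minimal_condition_if_dcc)
    show "filter_dcc TYPE('a)"
      using that by (intro filter_dcc_if_systems_have_least) simp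
  qed
qed

end
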